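(* Let $1\le k\le n$, $0<\alpha<1$, and let $P_1,\dots,P_n$ be $p$-values for null hypotheses $H_1,\dots,H_n$. Assume that $(P_1,\dots,P_n)$ have identical $k$th-order joint distributions under the null hypotheses, with $G_k$ being the c.d.f. of the maximum of any $k$ of them under the null hypotheses. Let $a_m=\binom{m}{k}$ and let $\alpha_k\le\cdots\le\alpha_n$ be defined by $G_k(\alpha_i)=\alpha/a_{n+k-i}$, $i=k,\dots,n$. (i) The single-step procedure that rejects any $H_i$ for which $P_i\le\alpha_k$ controls the $k$-FWER at $\alpha$. (ii) The generalized stepdown procedure that accepts any $H_{(i)}$ for which $i\ge\min_{1\le j\le n}\{j:P_{j:n}\ge\alpha_{\max(j,k)}\}$ if the minimum exists (rejecting the remaining hypotheses), and otherwise rejects all $H_{(i)}$, controls the $k$-FWER at $\alpha$.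
   Context: $P_{1:n}\le\cdots\le P_{n:n}$ are the ordered $p$-values, and $H_{(1)},\dots,H_{(n)}$ are the correspondingly ordered null hypotheses. Let $I_0\subseteq\{1,\dots,n\}$ be the (unknown, arbitrary) set of indices of true null hypotheses. The $k$-FWER of a procedure is the probability that it rejects at least $k$ of the true null hypotheses $H_i$, $i\in I_0$. "Controls the $k$-FWER at $\alpha$" is meant in the strong sense: the $k$-FWER is at most $\alpha$ for every configuration $I_0$ of true and false null hypotheses (it is trivially $0$ if $|I_0|<k$) and whatever the distribution of the $p$-values of the false null hypotheses and their dependence on the others. "Identical $k$th-order joint distributions under the null hypotheses" means that for all $J\subseteq I_0$ with $|J|=k$, the vectors $(P_j)_{j\in J}$ have the same joint distribution, not depending on $J$ or $I_0$; $G_k(u)=\Pr\{\max_{j\in J}P_j\le u\}$ for any such $J$. Each $P_i$ is uniform on $(0,1)$ when $H_i$ is true. No other assumption is made on the dependence among the $p$-values. *)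

theory Defs
  imports "HOL-Probability.Probability"
begin

text \<open>
  Hypotheses are indexed by \<open>{1..n}\<close>, and \<open>P i \<omega>\<close> is the \<open>i\<close>-th p-value.
\<close>

text \<open>
  The law on \<open>\<real>\<^sup>k\<close> of \<open>(P\<^sub>j)\<close> for \<open>j \<in> J\<close>, where \<open>k = |J|\<close> and \<open>J\<close> is listed in increasing
  order, so that the laws for different \<open>J\<close> live on one space and can be compared.
\<close>
definition joint_law :: "'a measure \<Rightarrow> (nat \<Rightarrow> 'a \<Rightarrow> real) \<Rightarrow> nat set \<Rightarrow> (nat \<Rightarrow> real) measure" where
  "joint_law M P J =
     distr M (\<Pi>\<^sub>M r\<in>{..<card J}. borel)
       (\<lambda>\<omega>. \<lambda>r\<in>{..<card J}. P (sorted_list_of_set J ! r) \<omega>)"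

text \<open>
  \<open>G\<^sub>k\<close>, where \<open>\<nu>\<close> is the common joint law of any \<open>k\<close> true-null p-values.
\<close>
definition max_cdf :: "nat \<Rightarrow> (nat \<Rightarrow> real) measure \<Rightarrow> real \<Rightarrow> real" where
  "max_cdf k \<nu> = cdf (distr \<nu> borel (\<lambda>x. Max (x ` {..<k})))"

text \<open>
  \<open>I0\<close> is the set of true nulls. The law \<open>\<nu>\<close> is a parameter, so it depends neither on \<open>J\<close> nor
  on \<open>I0\<close>. Nothing but measurability is required of the false-null p-values, and nothing of the
  dependence beyond the \<open>k\<close>-th order joint laws of the true-null p-values.
\<close>
definition null_configuration ::
  "'a measure \<Rightarrow> nat \<Rightarrow> nat \<Rightarrow> (nat \<Rightarrow> real) measure \<Rightarrow> nat set \<Rightarrow> (nat \<Rightarrow> 'a \<Rightarrow> real) \<Rightarrow> bool" where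
  "null_configuration M n k \<nu> I0 P \<longleftrightarrow>
     I0 \<subseteq> {1..n} \<and>
     (\<forall>i\<in>{1..n}. P i \<in> borel_measurable M) \<and>
     (\<forall>i\<in>I0. distr M lborel (P i) = uniform_measure lborel {0<..<1}) \<and>
     (\<forall>J. J \<subseteq> I0 \<and> card J = k \<longrightarrow> joint_law M P J = \<nu>)"

text \<open>
  A procedure \<open>R\<close> maps the vector of p-values to the set of indices of the rejected hypotheses.
\<close>
definition k_false_rejections ::
  "'a measure \<Rightarrow> nat \<Rightarrow> nat set \<Rightarrow> (nat \<Rightarrow> 'a \<Rightarrow> real) \<Rightarrow> ((nat \<Rightarrow> real) \<Rightarrow> nat set) \<Rightarrow> 'a set" where
  "k_false_rejections M k I0 P R = {\<omega> \<in> space M. k \<le> card (I0 \<inter> R (\<lambda>i. P i \<omega>))}"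

definition k_FWER ::
  "'a measure \<Rightarrow> nat \<Rightarrow> nat set \<Rightarrow> (nat \<Rightarrow> 'a \<Rightarrow> real) \<Rightarrow> ((nat \<Rightarrow> real) \<Rightarrow> nat set) \<Rightarrow> real" where
  "k_FWER M k I0 P R = measure M (k_false_rejections M k I0 P R)"

text \<open>
  Strong control. The measurability clause is there because \<^term>\<open>measure M A\<close> is \<open>0\<close> by
  convention for a non-measurable set \<open>A\<close>.
\<close>
definition controls_k_FWER ::
  "'a measure \<Rightarrow> nat \<Rightarrow> nat \<Rightarrow> (nat \<Rightarrow> real) measure \<Rightarrow> ((nat \<Rightarrow> real) \<Rightarrow> nat set) \<Rightarrow> real \<Rightarrow> bool" where
  "controls_k_FWER M n k \<nu> R \<alpha> \<longleftrightarrow>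
     (\<forall>I0 P. null_configuration M n k \<nu> I0 P \<longrightarrow>
        k_false_rejections M k I0 P R \<in> sets M \<and> k_FWER M k I0 P R \<le> \<alpha>)"

definition single_step :: "nat \<Rightarrow> real \<Rightarrow> (nat \<Rightarrow> real) \<Rightarrow> nat set" where
  "single_step n c p = {i \<in> {1..n}. p i \<le> c}"

text \<open>
  \<open>\<sigma> i\<close> is the index of \<open>H\<^sub>(\<^sub>i\<^sub>)\<close>, so the \<open>i\<close>-th smallest p-value is \<open>p (\<sigma> i)\<close>; ties may be
  broken in any way.
\<close>
definition is_ordering :: "nat \<Rightarrow> (nat \<Rightarrow> real) \<Rightarrow> (nat \<Rightarrow> nat) \<Rightarrow> bool" where
  "is_ordering n p \<sigma> \<longleftrightarrow>
     bij_betw \<sigma> {1..n} {1..n} \<and> mono_on {1..n} (\<lambda>i. p (\<sigma> i))"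

text \<open>
  \<open>c i\<close> is the critical value \<open>\<alpha>\<^sub>i\<close>, and \<open>ord p\<close> is an ordering of the p-values \<open>p\<close>.
\<close>
definition stepdown ::
  "nat \<Rightarrow> nat \<Rightarrow> (nat \<Rightarrow> real) \<Rightarrow> ((nat \<Rightarrow> real) \<Rightarrow> nat \<Rightarrow> nat) \<Rightarrow> (nat \<Rightarrow> real) \<Rightarrow> nat set" where
  "stepdown n k c ord p =
     (let S = {j \<in> {1..n}. p (ord p j) \<ge> c (max j k)}
      in if S = {} then {1..n}
         else {1..n} - ord p ` {i \<in> {1..n}. i \<ge> Min S})"

end

theory Submission
  imports Defs
begin

text \<open>
  If \<open>k\<close> of the true nulls have p-values at most \<open>x\<close>, then some \<open>k\<close>-subset of \<open>I0\<close> has maximum at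
  most \<open>x\<close>; the union bound over the \<open>|I0| choose k\<close> subsets gives (i).  For (ii), a step-down
  rejection of \<open>k\<close> true nulls forces the \<open>k\<close>-th smallest true p-value, whose rank is at most
  \<open>n - |I0| + k\<close>, to lie below the critical value of that index, which was chosen to make the same
  union bound equal to \<open>\<alpha>\<close>.
\<close>

section \<open>Distribution of the maximum of a block of p-values\<close>

lemma joint_law_map_measurable:
  assumes "\<And>j. j \<in> J \<Longrightarrow> P j \<in> borel_measurable M" and "finite J"
  shows "(\<lambda>\<omega>. \<lambda>r\<in>{..<card J}. P (sorted_list_of_set J ! r) \<omega>)
           \<in> M \<rightarrow>\<^sub>M (\<Pi>\<^sub>M r\<in>{..<card J}. borel)"
proof (rule measurable_restrict)
  fix r assume "r \<in> {..<card J}"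
  then have "sorted_list_of_set J ! r \<in> J"
    using assms(2) by (metis lessThan_iff nth_mem length_sorted_list_of_set set_sorted_list_of_set)
  then show "P (sorted_list_of_set J ! r) \<in> borel_measurable M" using assms(1) by blast
qed

text \<open>The event says that the maximum of the vector listing \<open>J\<close> in increasing
  order is at most \<open>x\<close>; pushing \<open>M\<close> forward to the joint law and then
  along \<open>Max\<close> gives its probability. Nonemptiness of \<open>J\<close> keeps
  \<open>Max\<close> meaningful.\<close>

lemma measure_all_le_eq_max_cdf:
  assumes meas: "\<And>j. j \<in> J \<Longrightarrow> P j \<in> borel_measurable M"
    and "finite J" and "J \<noteq> {}"
  shows "measure M {\<omega> \<in> space M. \<forall>j\<in>J. P j \<omega> \<le> x} = max_cdf (card J) (joint_law M P J) x"
proof -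
  let ?k = "card J"
  let ?X = "\<lambda>\<omega>. \<lambda>r\<in>{..<?k}. P (sorted_list_of_set J ! r) \<omega>"
  let ?N = "\<Pi>\<^sub>M r\<in>{..<?k}. (borel :: real measure)"
  let ?f = "\<lambda>y :: nat \<Rightarrow> real. Max (y ` {..<?k})"
  have k: "{..<?k} \<noteq> {}"
    using assms by (auto simp: lessThan_empty_iff)
  have X: "?X \<in> M \<rightarrow>\<^sub>M ?N"
    using meas \<open>finite J\<close> by (rule joint_law_map_measurable)
  have f: "?f \<in> borel_measurable ?N"
    by (intro borel_measurable_Max measurable_component_singleton) auto
  have J: "J = (\<lambda>r. sorted_list_of_set J ! r) ` {..<?k}"
    using \<open>finite J\<close> set_conv_nth[of "sorted_list_of_set J"] by auto
  have "(\<forall>j\<in>J. P j \<omega> \<le> x) \<longleftrightarrow> ?f (?X \<omega>) \<le> x" for \<omega>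
    using k by (subst J) (auto simp: Max_le_iff)
  then have "{\<omega> \<in> space M. \<forall>j\<in>J. P j \<omega> \<le> x} = (?f \<circ> ?X) -` {..x} \<inter> space M"
    by auto
  moreover have "max_cdf ?k (joint_law M P J) x = measure (distr M borel (?f \<circ> ?X)) {..x}"
    unfolding max_cdf_def joint_law_def cdf_def using distr_distr[OF f X] by simp
  moreover have "\<dots> = measure M ((?f \<circ> ?X) -` {..x} \<inter> space M)"
    using measurable_comp[OF X f] by (intro measure_distr) auto
  ultimately show ?thesis by simp
qed

section \<open>Counting events and the union bound\<close>

text \<open>Turns a count into a finite union over \<open>k\<close>-subsets, the form on which both
  measurability and the union bound rest.\<close>

lemma k_le_card_iff_subset:
  assumes "finite A"
  shows "k \<le> card {i \<in> A. Q i} \<longleftrightarrow> (\<exists>J\<in>{J. J \<subseteq> A \<and> card J = k}. \<forall>j\<in>J. Q j)"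
proof
  assume "k \<le> card {i \<in> A. Q i}"
  then obtain J where "J \<subseteq> {i \<in> A. Q i}" "card J = k"
    by (meson obtain_subset_with_card_n)
  then show "\<exists>J\<in>{J. J \<subseteq> A \<and> card J = k}. \<forall>j\<in>J. Q j" by blast
next
  assume "\<exists>J\<in>{J. J \<subseteq> A \<and> card J = k}. \<forall>j\<in>J. Q j"
  then obtain J where "J \<subseteq> {i \<in> A. Q i}" "card J = k" by blast
  then show "k \<le> card {i \<in> A. Q i}" using assms card_mono[of "{i \<in> A. Q i}" J] by simp
qed

lemma sets_k_le_card:
  assumes "finite A" and "\<And>i. i \<in> A \<Longrightarrow> {\<omega> \<in> space M. Q i \<omega>} \<in> sets M"
  shows "{\<omega> \<in> space M. k \<le> card {i \<in> A. Q i \<omega>}} \<in> sets M"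
  unfolding k_le_card_iff_subset[OF assms(1)]
proof (rule sets.sets_Collect_finite_Ex)
  show "{\<omega> \<in> space M. \<forall>j\<in>J. Q j \<omega>} \<in> sets M" if "J \<in> {J. J \<subseteq> A \<and> card J = k}" for J
    using that assms finite_subset by (intro sets.sets_Collect_finite_All) auto
  show "finite {J. J \<subseteq> A \<and> card J = k}" using assms(1) by simp
qed

lemma null_configurationD:
  assumes "null_configuration M n k \<nu> I0 P"
  shows "finite I0" "I0 \<subseteq> {1..n}" "\<And>i. i \<in> {1..n} \<Longrightarrow> P i \<in> borel_measurable M"
    "\<And>J. J \<subseteq> I0 \<Longrightarrow> card J = k \<Longrightarrow> joint_law M P J = \<nu>"
  using assms finite_subset[of I0 "{1..n}"] unfolding null_configuration_def by auto

text \<open>Each \<open>k\<close>-subset of \<open>I0\<close> has joint law \<open>\<nu>\<close>, so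
  all terms of the union bound are equal. If \<open>card I0 < k\<close>, the union is empty and the
  binomial coefficient is zero, so no case split arises.\<close>

lemma prob_k_nulls_le:
  assumes "prob_space M" and "1 \<le> k" and nc: "null_configuration M n k \<nu> I0 P"
  shows "measure M {\<omega> \<in> space M. k \<le> card {i \<in> I0. P i \<omega> \<le> x}}
           \<le> real (card I0 choose k) * max_cdf k \<nu> x"
proof -
  interpret prob_space M by fact
  note nc = null_configurationD[OF nc]
  let ?\<J> = "{J. J \<subseteq> I0 \<and> card J = k}"
  let ?E = "\<lambda>J. {\<omega> \<in> space M. \<forall>j\<in>J. P j \<omega> \<le> x}"
  have J: "finite J" "J \<noteq> {}" "\<And>j. j \<in> J \<Longrightarrow> P j \<in> borel_measurable M" if "J \<in> ?\<J>" for J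
    using that nc \<open>1 \<le> k\<close> finite_subset by auto
  have sets: "?E J \<in> sets M" if "J \<in> ?\<J>" for J
    using J[OF that] by (intro sets.sets_Collect_finite_All) auto
  have "{\<omega> \<in> space M. k \<le> card {i \<in> I0. P i \<omega> \<le> x}} = (\<Union>J\<in>?\<J>. ?E J)"
    unfolding k_le_card_iff_subset[OF nc(1)] by blast
  also have "prob \<dots> \<le> (\<Sum>J\<in>?\<J>. prob (?E J))"
    using sets nc(1) by (intro finite_measure_subadditive_finite) auto
  also have "\<dots> = (\<Sum>J\<in>?\<J>. max_cdf k \<nu> x)"
  proof (rule sum.cong)
    fix J assume "J \<in> ?\<J>"
    then show "prob (?E J) = max_cdf k \<nu> x"
      using measure_all_le_eq_max_cdf[of J P M x] J[of J] nc(4)[of J] by auto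
  qed simp
  also have "\<dots> = real (card I0 choose k) * max_cdf k \<nu> x"
    using n_subsets[OF nc(1)] by simp
  finally show ?thesis .
qed

lemma k_false_rejections_single_step:
  assumes "I0 \<subseteq> {1..n}"
  shows "k_false_rejections M k I0 P (single_step n x) =
           {\<omega> \<in> space M. k \<le> card {i \<in> I0. P i \<omega> \<le> x}}"
proof -
  have "I0 \<inter> single_step n x p = {i \<in> I0. p i \<le> x}" for p
    using assms by (auto simp: single_step_def)
  then show ?thesis by (simp add: k_false_rejections_def)
qed

section \<open>The stepdown procedure: ties, false rejections and measurability\<close>

text \<open>
  The rejection set is free of \<open>ord\<close>: monotonicity of \<open>c\<close> allows all members of a group of ties to
  be compared with the critical value of the smallest rank in the group.  This is what makes the
  procedure measurable although \<open>ord\<close> may break ties in a non-measurable way.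
\<close>
lemma stepdown_eq:
  assumes ord: "is_ordering n p (ord p)" and c: "mono_on {k..n} c" and "k \<le> n"
  shows "stepdown n k c ord p = {i \<in> {1..n}. \<forall>m\<in>{1..n}. p m \<le> p i \<longrightarrow>
           p m < c (max (card {l \<in> {1..n}. p l < p m} + 1) k)}"
proof -
  define \<sigma> where "\<sigma> = ord p"
  define q where "q j = p (\<sigma> j)" for j
  define S where "S = {j \<in> {1..n}. q j \<ge> c (max j k)}"
  \<comment> \<open>Counting strictly smaller values gives all members of a tie the first position
    of their group, whatever \<open>ord\<close> does.\<close>
  define rank where "rank m = card {l \<in> {1..n}. p l < p m} + 1" for m
  have bij: "bij_betw \<sigma> {1..n} {1..n}"
    and mono: "\<And>i j. 1 \<le> i \<Longrightarrow> i \<le> j \<Longrightarrow> j \<le> n \<Longrightarrow> q i \<le> q j"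
    using ord unfolding is_ordering_def \<sigma>_def q_def mono_on_def by auto
  have img: "\<sigma> ` {1..n} = {1..n}" and inj: "inj_on \<sigma> {1..n}"
    using bij by (auto simp: bij_betw_def)
  have \<sigma>: "\<sigma> j \<in> {1..n}" if "j \<in> {1..n}" for j using that img by blast
  have rank: "rank (\<sigma> j) \<in> {1..j} \<and> q (rank (\<sigma> j)) = q j
      \<and> (\<forall>i\<in>{1..<rank (\<sigma> j)}. q i < q j)" if j: "j \<in> {1..n}" for j
  proof -
    \<comment> \<open>\<open>a\<close> is the first position of the tie group of \<open>j\<close>.
      As \<open>q\<close> is sorted, exactly the positions before \<open>a\<close> carry smaller
      values, so the rank is \<open>(a - 1) + 1\<close>.\<close>
    define a where "a = (LEAST i. i \<in> {1..n} \<and> q i = q j)"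
    have a: "a \<in> {1..n}" "q a = q j" and "a \<le> j"
      using j LeastI[of "\<lambda>i. i \<in> {1..n} \<and> q i = q j" j]
        Least_le[of "\<lambda>i. i \<in> {1..n} \<and> q i = q j" j] unfolding a_def by auto
    have least: "q i < q j" if "i \<in> {1..<a}" for i
    proof -
      have "i \<in> {1..n}" "q i \<le> q a" using that a(1) mono[of i a] by auto
      moreover have "q i \<noteq> q j"
        using that \<open>i \<in> {1..n}\<close> not_less_Least[of i "\<lambda>i. i \<in> {1..n} \<and> q i = q j"]
        unfolding a_def by auto
      ultimately show ?thesis using a(2) by simp
    qed
    have "{i \<in> {1..n}. q i < q j} = {1..<a}"
    proof (intro set_eqI iffI)
      fix i assume i: "i \<in> {i \<in> {1..n}. q i < q j}"
      then have "i < a" using mono[of a i] a by (metis atLeastAtMost_iff leD leI mem_Collect_eq)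
      then show "i \<in> {1..<a}" using i by simp
    next
      fix i assume i: "i \<in> {1..<a}"
      then have "i \<in> {1..n}" using a(1) by auto
      then show "i \<in> {i \<in> {1..n}. q i < q j}" using least[OF i] by blast
    qed
    moreover have "{l \<in> {1..n}. p l < p (\<sigma> j)} = \<sigma> ` {i \<in> {1..n}. q i < q j}"
      unfolding q_def by (subst img[symmetric]) auto
    moreover have "inj_on \<sigma> {i \<in> {1..n}. q i < q j}"
      using inj by (rule inj_on_subset) auto
    ultimately have "rank (\<sigma> j) = a"
      unfolding rank_def using a(1) by (simp add: card_image)
    then show ?thesis using a least \<open>a \<le> j\<close> by auto
  qed
  \<comment> \<open>Position \<open>r\<close> is rejected iff the first crossing of a critical value
    comes after \<open>r\<close>.\<close>
  have rej: "\<sigma> r \<in> stepdown n k c ord p \<longleftrightarrow> (\<forall>j\<in>{1..r}. q j < c (max j k))" if r: "r \<in> {1..n}" for r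
  proof -
    have "\<sigma> r \<in> stepdown n k c ord p \<longleftrightarrow> S = {} \<or> r < Min S"
    proof -
      have "\<sigma> r \<in> \<sigma> ` {i \<in> {1..n}. i \<ge> Min S} \<longleftrightarrow> r \<ge> Min S"
        using r by (subst inj_on_image_mem_iff[OF inj r]) auto
      moreover have "stepdown n k c ord p =
          (if S = {} then {1..n} else {1..n} - \<sigma> ` {i \<in> {1..n}. i \<ge> Min S})"
        by (simp only: stepdown_def Let_def S_def q_def \<sigma>_def)
      ultimately show ?thesis using \<sigma>[OF r] by (simp only: not_le split: if_split) auto
    qed
    also have "\<dots> \<longleftrightarrow> (\<forall>j\<in>S. r < j)"
      by (cases "S = {}") (auto simp: S_def)
    also have "\<dots> \<longleftrightarrow> (\<forall>j\<in>{1..r}. q j < c (max j k))"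
    proof -
      have "j \<in> {1..r} \<longleftrightarrow> j \<in> {1..n} \<and> \<not> r < j" for j using r by auto
      then show ?thesis unfolding S_def by (simp only: not_le[symmetric]) blast
    qed
    finally show ?thesis .
  qed
  have key: "(\<forall>j\<in>{1..r}. q j < c (max j k)) \<longleftrightarrow>
      (\<forall>m\<in>{1..n}. p m \<le> p (\<sigma> r) \<longrightarrow> p m < c (max (rank m) k))" if r: "r \<in> {1..n}" for r
  proof
    assume L: "\<forall>j\<in>{1..r}. q j < c (max j k)"
    show "\<forall>m\<in>{1..n}. p m \<le> p (\<sigma> r) \<longrightarrow> p m < c (max (rank m) k)"
    proof (intro ballI impI)
      fix m assume "m \<in> {1..n}" and le: "p m \<le> p (\<sigma> r)"
      then obtain j where j: "j \<in> {1..n}" "m = \<sigma> j" using img by blast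
      \<comment> \<open>In a tie, \<open>m\<close> itself may be placed after \<open>r\<close>, but
        its rank cannot be: all positions before the rank hold strictly smaller values.\<close>
      have "rank m \<le> r"
      proof (rule ccontr)
        assume "\<not> rank m \<le> r"
        then have "q r < q j" using rank[OF j(1)] j(2) r by auto
        then show False using le j(2) by (simp add: q_def)
      qed
      then have "rank m \<in> {1..r}" using rank[OF j(1)] j(2) by simp
      then have "q (rank m) < c (max (rank m) k)" using L by blast
      then show "p m < c (max (rank m) k)"
        using rank[OF j(1)] j(2) by (simp add: q_def)
    qed
  next
    assume R: "\<forall>m\<in>{1..n}. p m \<le> p (\<sigma> r) \<longrightarrow> p m < c (max (rank m) k)"
    show "\<forall>j\<in>{1..r}. q j < c (max j k)"
    proof
      fix j assume "j \<in> {1..r}"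
      then have j: "j \<in> {1..n}" "q j \<le> q r" using r mono[of j r] by auto
      then have "q j < c (max (rank (\<sigma> j)) k)"
        using R \<sigma>[OF j(1)] by (simp add: q_def)
      \<comment> \<open>The rank is at most the actual position \<open>j\<close>, so monotonicity of
        \<open>c\<close> passes from the one to the other; \<open>max\<close> with \<open>k\<close>
        keeps both arguments in \<open>{k..n}\<close>.\<close>
      also have "\<dots> \<le> c (max j k)"
        using rank[OF j(1)] j(1) \<open>k \<le> n\<close> by (intro mono_onD[OF c]) auto
      finally show "q j < c (max j k)" .
    qed
  qed
  have sub: "stepdown n k c ord p \<subseteq> {1..n}"
    unfolding stepdown_def Let_def by auto
  have "i \<in> stepdown n k c ord p \<longleftrightarrow>
      (\<forall>m\<in>{1..n}. p m \<le> p i \<longrightarrow> p m < c (max (rank m) k))" if "i \<in> {1..n}" for i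
  proof -
    have "i \<in> \<sigma> ` {1..n}" unfolding img by (rule that)
    then obtain r where r: "r \<in> {1..n}" "i = \<sigma> r" by (rule imageE) auto
    show ?thesis unfolding r(2) rej[OF r(1)] by (rule key[OF r(1)])
  qed
  then have "{i \<in> {1..n}. i \<in> stepdown n k c ord p} =
      {i \<in> {1..n}. \<forall>m\<in>{1..n}. p m \<le> p i \<longrightarrow> p m < c (max (rank m) k)}"
    by (intro Collect_cong conj_cong refl)
  moreover have "{i \<in> {1..n}. i \<in> stepdown n k c ord p} = stepdown n k c ord p"
    using sub by blast
  ultimately show ?thesis by (simp only: rank_def)
qed

text \<open>
  Otherwise the smallest rejected true p-value not below the critical value would have rank at most
  \<open>n - |I0| + k\<close>, so it would not have been rejected.
\<close>
lemma stepdown_k_false_rejections_imp: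
  assumes ord: "is_ordering n p (ord p)" and c: "mono_on {k..n} c" and "k \<le> n"
    and I0: "I0 \<subseteq> {1..n}" "k \<le> card I0"
    and k: "k \<le> card (I0 \<inter> stepdown n k c ord p)"
  shows "k \<le> card {i \<in> I0. p i \<le> c (n - card I0 + k)}"
proof (rule ccontr)
  let ?x = "c (n - card I0 + k)"
  let ?R = "stepdown n k c ord p"
  let ?J = "{i \<in> I0. p i \<le> ?x}"
  assume less: "\<not> k \<le> card ?J"
  define thr where "thr m = c (max (card {l \<in> {1..n}. p l < p m} + 1) k)" for m
  have R: "?R = {i \<in> {1..n}. \<forall>m\<in>{1..n}. p m \<le> p i \<longrightarrow> p m < thr m}"
    unfolding thr_def using ord c \<open>k \<le> n\<close> by (rule stepdown_eq)
  have fin: "finite I0" using I0(1) finite_subset by blast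
  define i where "i = arg_min_on p (I0 \<inter> ?R - ?J)"
  have "\<not> I0 \<inter> ?R \<subseteq> ?J"
    using less k card_mono[of ?J "I0 \<inter> ?R"] fin by auto
  then have "I0 \<inter> ?R - ?J \<noteq> {}" and "finite (I0 \<inter> ?R - ?J)" using fin by blast+
  then have i: "i \<in> I0 \<inter> ?R - ?J" and min: "\<not> (\<exists>l \<in> I0 \<inter> ?R - ?J. p l < p i)"
    unfolding i_def by (simp_all only: arg_min_if_finite not_False_eq_True)
  have below: "p m < thr m" if "m \<in> {1..n}" "p m \<le> p i" for m
    using i that unfolding R by blast
  \<comment> \<open>Rejection is inherited by smaller p-values, so a true null strictly below
    \<open>i\<close> is rejected too; minimality of \<open>i\<close> then puts it in
    \<open>?J\<close>.\<close>
  have "l \<in> ?J" if l: "l \<in> I0" "p l < p i" for l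
  proof -
    have "p m < thr m" if "m \<in> {1..n}" "p m \<le> p l" for m
      using that l(2) by (intro below) auto
    then have "l \<in> ?R" using l(1) I0(1) unfolding R by blast
    then show ?thesis using l min by blast
  qed
  then have "{l \<in> {1..n}. p l < p i} \<subseteq> ({1..n} - I0) \<union> ?J" by blast
  then have "card {l \<in> {1..n}. p l < p i} \<le> card (({1..n} - I0) \<union> ?J)"
    using fin by (intro card_mono) auto
  also have "\<dots> \<le> card ({1..n} - I0) + card ?J" by (rule card_Un_le)
  also have "card ({1..n} - I0) = n - card I0"
    using I0(1) fin by (simp add: card_Diff_subset)
  \<comment> \<open>At most \<open>n - card I0\<close> false nulls and \<open>k - 1\<close> members
    of \<open>?J\<close> lie strictly below \<open>p i\<close>; the \<open>+ 1\<close> of the rank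
    uses up the slack in \<open>card ?J < k\<close>.\<close>
  finally have rank: "card {l \<in> {1..n}. p l < p i} + 1 \<le> n - card I0 + k"
    using less by linarith
  have "p i < thr i" using i I0(1) by (intro below) auto
  also have "\<dots> \<le> ?x" unfolding thr_def
    using rank I0(2) card_mono[OF _ I0(1)] \<open>k \<le> n\<close> by (intro mono_onD[OF c]) auto
  finally show False using i by auto
qed

text \<open>By \<open>stepdown_eq\<close>, rejection is a finite conjunction of comparisons among
  p-values and critical values indexed by ranks, in which \<open>ord\<close> no longer
  occurs.\<close>

lemma sets_k_false_rejections_stepdown:
  assumes ord: "\<forall>p. is_ordering n p (ord p)" and c: "mono_on {k..n} c" and "k \<le> n"
    and I0: "I0 \<subseteq> {1..n}" and P: "\<And>i. i \<in> {1..n} \<Longrightarrow> P i \<in> borel_measurable M"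
  shows "k_false_rejections M k I0 P (stepdown n k c ord) \<in> sets M"
proof -
  let ?N = "\<lambda>m \<omega>. card {l \<in> {1..n}. P l \<omega> < P m \<omega>}"
  let ?Q = "\<lambda>i \<omega>. \<forall>m\<in>{1..n}. P m \<omega> \<le> P i \<omega> \<longrightarrow> P m \<omega> < c (max (?N m \<omega> + 1) k)"
  have "I0 \<inter> stepdown n k c ord (\<lambda>i. P i \<omega>) = {i \<in> I0. ?Q i \<omega>}" for \<omega>
    using I0 stepdown_eq[of n "\<lambda>i. P i \<omega>" ord, OF _ c \<open>k \<le> n\<close>] ord by auto
  then have "k_false_rejections M k I0 P (stepdown n k c ord) =
      {\<omega> \<in> space M. k \<le> card {i \<in> I0. ?Q i \<omega>}}"
    by (simp add: k_false_rejections_def)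
  also have "\<dots> \<in> sets M"
  proof (rule sets_k_le_card)
    show "finite I0" using I0 finite_subset by blast
    fix i assume "i \<in> I0"
    then have [measurable]: "P i \<in> borel_measurable M" using I0 P by auto
    show "{\<omega> \<in> space M. ?Q i \<omega>} \<in> sets M"
    proof (rule sets.sets_Collect_finite_All)
      fix m assume m: "m \<in> {1..n}"
      then have [measurable]: "P m \<in> borel_measurable M" by (rule P)
      have "?N m \<in> M \<rightarrow>\<^sub>M count_space UNIV"
      proof -
        have "?N m = (\<lambda>\<omega>. \<Sum>l\<in>{1..n}. if P l \<omega> < P m \<omega> then 1 else 0)"
          by (simp only: card_eq_sum sum.inter_filter finite_atLeastAtMost)
        moreover have "\<dots> \<in> M \<rightarrow>\<^sub>M count_space UNIV"
          using P by (intro measurable_sum_nat) (auto intro!: measurable_If)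
        ultimately show ?thesis by simp
      qed
      \<comment> \<open>The count is measurable into a discrete space, from which every function, in
        particular \<open>c\<close>, is measurable.\<close>
      then have [measurable]: "(\<lambda>\<omega>. c (max (?N m \<omega> + 1) k)) \<in> borel_measurable M"
        by (rule measurable_compose) simp
      show "{\<omega> \<in> space M. P m \<omega> \<le> P i \<omega> \<longrightarrow> P m \<omega> < c (max (?N m \<omega> + 1) k)} \<in> sets M"
        by measurable
    qed auto
  qed
  finally show ?thesis .
qed

section \<open>Strong control by both procedures\<close>

theorem theorem4p1:
  fixes M :: "'a measure"
    and n k :: nat
    and \<alpha> :: real
    and \<nu> :: "(nat \<Rightarrow> real) measure"
    and c :: "nat \<Rightarrow> real"
    and ord :: "(nat \<Rightarrow> real) \<Rightarrow> nat \<Rightarrow> nat"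
  assumes "prob_space M"
    and "1 \<le> k" and "k \<le> n"
    and "0 < \<alpha>" and "\<alpha> < 1"
    and "prob_space \<nu>" and "sets \<nu> = sets (\<Pi>\<^sub>M r\<in>{..<k}. (borel :: real measure))"
    and "mono_on {k..n} c"
    and "\<forall>i\<in>{k..n}. max_cdf k \<nu> (c i) = \<alpha> / real ((n + k - i) choose k)"
    and "\<forall>p. is_ordering n p (ord p)"
  shows "controls_k_FWER M n k \<nu> (single_step n (c k)) \<alpha>
       \<and> controls_k_FWER M n k \<nu> (stepdown n k c ord) \<alpha>"
proof -
  interpret prob_space M by fact
  let ?E = "\<lambda>I0 P x. {\<omega> \<in> space M. k \<le> card {i \<in> I0. P i \<omega> \<le> x}}"
  have sets: "?E I0 P x \<in> sets M" if "null_configuration M n k \<nu> I0 P" for I0 x and P :: "nat \<Rightarrow> 'a \<Rightarrow> real"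
  proof (rule sets_k_le_card)
    fix i assume "i \<in> I0"
    then have [measurable]: "P i \<in> borel_measurable M"
      using null_configurationD[OF that] by auto
    show "{\<omega> \<in> space M. P i \<omega> \<le> x} \<in> sets M" by measurable
  qed (use null_configurationD[OF that] in auto)
  have card_le: "card I0 \<le> n" if "null_configuration M n k \<nu> I0 P" for I0 P
    using card_mono[OF _ null_configurationD(2)[OF that]] by simp
  have "controls_k_FWER M n k \<nu> (single_step n (c k)) \<alpha>"
    unfolding controls_k_FWER_def k_FWER_def
  proof (intro allI impI)
    fix I0 P assume nc: "null_configuration M n k \<nu> I0 P"
    have "prob (?E I0 P (c k)) \<le> real (card I0 choose k) * max_cdf k \<nu> (c k)"
      by (rule prob_k_nulls_le) fact+
    \<comment> \<open>At \<open>i = k\<close> the calibration has \<open>n + k - k = n\<close>, the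
      largest possible number of true nulls; the next step bounds \<open>card I0 choose k\<close> by
      this worst case.\<close>
    also have "\<dots> = real (card I0 choose k) * (\<alpha> / real (n choose k))"
      using assms(9) \<open>k \<le> n\<close> by simp
    also have "\<dots> \<le> real (n choose k) * (\<alpha> / real (n choose k))"
      using card_le[OF nc] \<open>0 < \<alpha>\<close> by (intro mult_right_mono) (auto intro: binomial_right_mono)
    also have "\<dots> = \<alpha>" using \<open>k \<le> n\<close> by simp
    finally show "k_false_rejections M k I0 P (single_step n (c k)) \<in> sets M \<and>
        prob (k_false_rejections M k I0 P (single_step n (c k))) \<le> \<alpha>"
      by (simp add: sets[OF nc] k_false_rejections_single_step[OF null_configurationD(2)[OF nc]])
  qed
  moreover have "controls_k_FWER M n k \<nu> (stepdown n k c ord) \<alpha>"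
    unfolding controls_k_FWER_def k_FWER_def
  proof (intro allI impI conjI)
    fix I0 P assume nc: "null_configuration M n k \<nu> I0 P"
    note I0 = null_configurationD[OF nc]
    show "k_false_rejections M k I0 P (stepdown n k c ord) \<in> sets M"
      using sets_k_false_rejections_stepdown[OF assms(10,8,3) I0(2,3)] .
    show "prob (k_false_rejections M k I0 P (stepdown n k c ord)) \<le> \<alpha>"
    proof (cases "k \<le> card I0")
      case True
      \<comment> \<open>The index \<open>i\<close> solves \<open>n + k - i = card I0\<close>, so the
        calibration cancels the binomial factor of the union bound exactly. It lies in
        \<open>{k..n}\<close> because \<open>k \<le> card I0\<close>, which also makes that factor
        nonzero.\<close>
      let ?x = "c (n - card I0 + k)"
      have "n - card I0 + k \<in> {k..n}" and "n + k - (n - card I0 + k) = card I0"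
        using card_le[OF nc] True by auto
      then have cdf: "max_cdf k \<nu> ?x = \<alpha> / real (card I0 choose k)"
        using assms(9) by metis
      have "k_false_rejections M k I0 P (stepdown n k c ord) \<subseteq> ?E I0 P ?x"
        using stepdown_k_false_rejections_imp[OF _ assms(8,3) I0(2) True] assms(10)
        unfolding k_false_rejections_def by blast
      then have "prob (k_false_rejections M k I0 P (stepdown n k c ord)) \<le> prob (?E I0 P ?x)"
        using sets[OF nc] by (rule finite_measure_mono)
      also have "\<dots> \<le> real (card I0 choose k) * max_cdf k \<nu> ?x"
        by (rule prob_k_nulls_le) fact+
      also have "\<dots> = real (card I0 choose k) * (\<alpha> / real (card I0 choose k))"
        using cdf by simp
      also have "\<dots> = \<alpha>" using True by simp
      finally show ?thesis .
    next
      case False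
      have "card (I0 \<inter> R) < k" for R
        using False card_mono[OF I0(1), of "I0 \<inter> R"] by simp
      then have "k_false_rejections M k I0 P (stepdown n k c ord) = {}"
        by (auto simp: k_false_rejections_def not_le)
      then show ?thesis using \<open>0 < \<alpha>\<close> by simp
    qed
  qed
  ultimately show ?thesis by blast
qed

end
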